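(* Let $\mathcal{E}=\{p_\lambda : \lambda\in\Lambda\}$ be a full regular and steep exponential family of densities on $(\mathcal{X},\mathcal{F},\mu)$ with source parameter $\lambda\in\Lambda$, natural parameter space $\Theta\subset\mathbb{R}^D$, and bijective ordinary-to-natural parameter conversion function $\theta:\Lambda\to\Theta$. For $\alpha\in(0,1)$ and $\lambda_1,\lambda_2\in\Lambda$, put $$M_{\theta,\alpha}(\lambda_1,\lambda_2):=\theta^{-1}\left(\alpha\,\theta(\lambda_1)+(1-\alpha)\,\theta(\lambda_2)\right).$$ Then, for every $\alpha\in(0,1)$, all $\lambda_1,\lambda_2\in\Lambda$ and every $\omega\in\mathcal{X}$, $$D_{B,\alpha}[p_{\lambda_1}:p_{\lambda_2}]=\log\left(\frac{p_{M_{\theta,\alpha}(\lambda_1,\lambda_2)}(\omega)}{p_{\lambda_1}(\omega)^{\alpha}\,p_{\lambda_2}(\omega)^{1-\alpha}}\right).$$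
   Context: $(\mathcal{X},\mathcal{F},\mu)$ is a measure space with positive measure $\mu$. An exponential family of order $D$ with source parameter $\lambda\in\Lambda$ has densities with respect to $\mu$ $$p_\lambda(x)=\exp\left(\theta(\lambda)^\top t(x)-F(\theta(\lambda))+k(x)\right),\quad x\in\mathcal{X},$$ where $t:\mathcal{X}\to\mathbb{R}^D$ is the (minimal) sufficient statistic, $k:\mathcal{X}\to\mathbb{R}$ is the carrier term, $\theta:\Lambda\to\Theta$ is a bijection (with inverse $\theta^{-1}$), and $F(\theta)=\log\int_{\mathcal{X}}\exp(\theta^\top t(x)+k(x))\,\mathrm{d}\mu(x)$ is the cumulant function. Full regular means that $\Theta$ is the set of all $\theta\in\mathbb{R}^D$ for which this integral is finite, and that it is a non-empty open convex set. Steep means that $\{E_{p_\lambda}[t(x)]:\lambda\in\Lambda\}$ equals the interior of the closed convex hull of $\{t(x):x\in\mathcal{X}\}$. All densities of the family have the same support $\mathcal{X}$ (they are strictly positive at every point of $\mathcal{X}$). For densities $p,q$ and $\alpha\in(0,1)$, the $\alpha$-skewed Bhattacharyya distance is $D_{B,\alpha}[p:q]=-\log\int_{\mathcal{X}}p(x)^{\alpha}q(x)^{1-\alpha}\,\mathrm{d}\mu(x)$. *)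

theory Defs
  imports "HOL-Analysis.Analysis"
begin

definition natural_space ::
    "'x measure \<Rightarrow> ('x \<Rightarrow> real ^ 'd) \<Rightarrow> ('x \<Rightarrow> real) \<Rightarrow> (real ^ 'd) set" where
  "natural_space M t k = {v. integrable M (\<lambda>x. exp (v \<bullet> t x + k x))}"

text \<open>Only meaningful on \<open>natural_space M t k\<close>: elsewhere the Bochner integral is 0 by convention.\<close>

definition cumulant ::
    "'x measure \<Rightarrow> ('x \<Rightarrow> real ^ 'd) \<Rightarrow> ('x \<Rightarrow> real) \<Rightarrow> real ^ 'd \<Rightarrow> real" where
  "cumulant M t k v = ln (\<integral>x. exp (v \<bullet> t x + k x) \<partial>M)"

definition ef_density ::
    "'x measure \<Rightarrow> ('x \<Rightarrow> real ^ 'd) \<Rightarrow> ('x \<Rightarrow> real) \<Rightarrow> ('l \<Rightarrow> real ^ 'd) \<Rightarrow> 'l \<Rightarrow> 'x \<Rightarrow> real" where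
  "ef_density M t k \<theta> l x = exp (\<theta> l \<bullet> t x - cumulant M t k (\<theta> l) + k x)"

text \<open>Minimality: the functions \<open>1, t\<^sub>1, \<dots>, t\<^sub>D\<close> are linearly independent modulo null sets,
  so that the order of the family is exactly \<open>D\<close>.\<close>

definition minimal_statistic :: "'x measure \<Rightarrow> ('x \<Rightarrow> real ^ 'd) \<Rightarrow> bool" where
  "minimal_statistic M t \<longleftrightarrow> (\<forall>a c. (AE x in M. a \<bullet> t x = c) \<longrightarrow> a = 0)"

text \<open>The sample space is \<open>space M\<close>, and \<open>\<Theta>\<close> is the natural parameter space. A null measure is
  excluded because then the cumulant function would be the logarithm of 0.\<close>

locale exponential_family =
  fixes M :: "'x measure"
    and t :: "'x \<Rightarrow> real ^ 'd"
    and k :: "'x \<Rightarrow> real"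
    and \<Lambda> :: "'l set"
    and \<Theta> :: "(real ^ 'd) set"
    and \<theta> :: "'l \<Rightarrow> real ^ 'd"
  assumes nonnull: "emeasure M (space M) \<noteq> 0"
    and t_measurable: "t \<in> borel_measurable M"
    and k_measurable: "k \<in> borel_measurable M"
    and minimal: "minimal_statistic M t"
    and \<Theta>_subset: "\<Theta> \<subseteq> natural_space M t k"
    and \<theta>_bij: "bij_betw \<theta> \<Lambda> \<Theta>"

definition full_regular ::
    "'x measure \<Rightarrow> ('x \<Rightarrow> real ^ 'd) \<Rightarrow> ('x \<Rightarrow> real) \<Rightarrow> (real ^ 'd) set \<Rightarrow> bool" where
  "full_regular M t k \<Theta> \<longleftrightarrow>
     \<Theta> = natural_space M t k \<and> \<Theta> \<noteq> {} \<and> open \<Theta> \<and> convex \<Theta>"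

text \<open>Expectation of a vector-valued statistic under the law with density \<open>p\<close> with respect to \<open>M\<close>.\<close>

definition density_expectation ::
    "'x measure \<Rightarrow> ('x \<Rightarrow> real) \<Rightarrow> ('x \<Rightarrow> real ^ 'd) \<Rightarrow> real ^ 'd" where
  "density_expectation M p f = (\<integral>x. f x \<partial>density M (\<lambda>x. ennreal (p x)))"

definition steep ::
    "'x measure \<Rightarrow> ('x \<Rightarrow> real ^ 'd) \<Rightarrow> ('x \<Rightarrow> real) \<Rightarrow> 'l set \<Rightarrow> ('l \<Rightarrow> real ^ 'd) \<Rightarrow> bool" where
  "steep M t k \<Lambda> \<theta> \<longleftrightarrow>
     {density_expectation M (ef_density M t k \<theta> l) t | l. l \<in> \<Lambda>} =
     interior (closure (convex hull (t ` space M)))"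

definition bhattacharyya_dist ::
    "'x measure \<Rightarrow> real \<Rightarrow> ('x \<Rightarrow> real) \<Rightarrow> ('x \<Rightarrow> real) \<Rightarrow> real" where
  "bhattacharyya_dist M \<alpha> p q = - ln (\<integral>x. p x powr \<alpha> * q x powr (1 - \<alpha>) \<partial>M)"

text \<open>The inverse of \<open>\<theta>\<close> is its inverse as a bijection from \<open>\<Lambda>\<close> onto the natural parameter space.\<close>

definition param_mean ::
    "'l set \<Rightarrow> ('l \<Rightarrow> real ^ 'd) \<Rightarrow> real \<Rightarrow> 'l \<Rightarrow> 'l \<Rightarrow> 'l" where
  "param_mean \<Lambda> \<theta> \<alpha> l1 l2 = inv_into \<Lambda> \<theta> (\<alpha> *\<^sub>R \<theta> l1 + (1 - \<alpha>) *\<^sub>R \<theta> l2)"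

end

theory Submission
  imports Defs
begin

text \<open>
  Write \<open>m\<close> for the parameter whose natural parameter is \<open>\<alpha> \<theta>(l1) + (1 - \<alpha>) \<theta>(l2)\<close>.
  The exponent of a density is affine in the natural parameter up to the cumulant, so the
  geometric mixture \<open>p\<^sub>1\<^sup>\<alpha> p\<^sub>2\<^sup>1\<^sup>-\<^sup>\<alpha>\<close> of two members of the family is the member \<open>p\<^sub>m\<close> multiplied by a
  factor \<open>exp (-J)\<close> that does not depend on the sample point; \<open>J\<close> is the skewed Jensen gap of the
  cumulant (lemma \<open>geometric_mixture_eq\<close>). Convexity of the natural parameter space puts the natural
  parameter of \<open>p\<^sub>m\<close> in it, so \<open>p\<^sub>m\<close> has integral 1 (lemma \<open>integral_ef_density\<close>), and
  integrating the mixture gives \<open>exp (-J)\<close>. Hence \<open>J\<close> is the Bhattacharyya distance, and it can be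
  read off at any one point \<open>\<omega>\<close> as the log-ratio of \<open>p\<^sub>m\<close> to the mixture.
\<close>

definition jensen_gap :: "('v::real_vector \<Rightarrow> real) \<Rightarrow> real \<Rightarrow> 'v \<Rightarrow> 'v \<Rightarrow> real" where
  "jensen_gap F \<alpha> u v = \<alpha> * F u + (1 - \<alpha>) * F v - F (\<alpha> *\<^sub>R u + (1 - \<alpha>) *\<^sub>R v)"

text \<open>The carrier term has total weight \<open>\<alpha> + (1 - \<alpha>) = 1\<close> in the mixture and so reappears unchanged;
  only the cumulants fail to combine, and they are constant in \<open>x\<close>.\<close>

lemma geometric_mixture_eq:
  assumes "\<theta> m = \<alpha> *\<^sub>R \<theta> l1 + (1 - \<alpha>) *\<^sub>R \<theta> l2"
  shows "ef_density M t k \<theta> l1 x powr \<alpha> * ef_density M t k \<theta> l2 x powr (1 - \<alpha>) =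
    exp (- jensen_gap (cumulant M t k) \<alpha> (\<theta> l1) (\<theta> l2)) * ef_density M t k \<theta> m x"
  unfolding ef_density_def jensen_gap_def assms powr_def
  by (simp add: exp_add [symmetric] inner_add_left algebra_simps)

text \<open>The partition function must be positive for its logarithm to undo it: a nonnegative integrand
  with integral 0 vanishes almost everywhere, which an exponential can do only on a null space.\<close>

lemma exp_cumulant:
  assumes "emeasure M (space M) \<noteq> 0" and "v \<in> natural_space M t k"
  shows "exp (cumulant M t k v) = (\<integral>x. exp (v \<bullet> t x + k x) \<partial>M)"
proof -
  let ?f = "\<lambda>x. exp (v \<bullet> t x + k x)"
  have int: "integrable M ?f"
    using assms(2) by (simp add: natural_space_def)
  have "integral\<^sup>L M ?f \<noteq> 0"
  proof
    assume "integral\<^sup>L M ?f = 0"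
    then have "AE x in M. ?f x = 0"
      using integral_nonneg_eq_0_iff_AE[OF int] by simp
    then have "AE x in M. False" by simp
    then show False
      using assms(1) by (simp add: AE_iff_measurable[OF sets.top])
  qed
  moreover have "integral\<^sup>L M ?f \<ge> 0" by simp
  ultimately have "integral\<^sup>L M ?f > 0" by linarith
  then show ?thesis by (simp add: cumulant_def)
qed

lemma integral_ef_density:
  assumes "emeasure M (space M) \<noteq> 0" and "\<theta> l \<in> natural_space M t k"
  shows "(\<integral>x. ef_density M t k \<theta> l x \<partial>M) = 1"
proof -
  have "ef_density M t k \<theta> l x =
      exp (\<theta> l \<bullet> t x + k x) / exp (cumulant M t k (\<theta> l))" for x
    by (simp add: ef_density_def exp_diff [symmetric] algebra_simps)
  then show ?thesis
    by (simp add: exp_cumulant[OF assms, symmetric])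
qed

theorem mainTheorem2:
  fixes M :: "'x measure"
    and t :: "'x \<Rightarrow> real ^ 'd"
    and k :: "'x \<Rightarrow> real"
    and \<Lambda> :: "'l set"
    and \<Theta> :: "(real ^ 'd) set"
    and \<theta> :: "'l \<Rightarrow> real ^ 'd"
    and \<alpha> :: real
    and l1 l2 :: 'l
    and \<omega> :: 'x
  assumes "exponential_family M t k \<Lambda> \<Theta> \<theta>"
    and "full_regular M t k \<Theta>"
    and "steep M t k \<Lambda> \<theta>"
    and "0 < \<alpha>" and "\<alpha> < 1"
    and "l1 \<in> \<Lambda>" and "l2 \<in> \<Lambda>"
    and "\<omega> \<in> space M"
  shows "bhattacharyya_dist M \<alpha> (ef_density M t k \<theta> l1) (ef_density M t k \<theta> l2) =
    ln (ef_density M t k \<theta> (param_mean \<Lambda> \<theta> \<alpha> l1 l2) \<omega> /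
        (ef_density M t k \<theta> l1 \<omega> powr \<alpha> * ef_density M t k \<theta> l2 \<omega> powr (1 - \<alpha>)))"
proof -
  interpret exponential_family M t k \<Lambda> \<Theta> \<theta> by fact
  let ?p = "ef_density M t k \<theta>"
  let ?m = "param_mean \<Lambda> \<theta> \<alpha> l1 l2"
  let ?J = "jensen_gap (cumulant M t k) \<alpha> (\<theta> l1) (\<theta> l2)"
  let ?v = "\<alpha> *\<^sub>R \<theta> l1 + (1 - \<alpha>) *\<^sub>R \<theta> l2"
  have "\<theta> l1 \<in> \<Theta>" "\<theta> l2 \<in> \<Theta>"
    using \<theta>_bij assms(6,7) by (auto simp: bij_betw_def)
  moreover have "convex \<Theta>"
    using assms(2) unfolding full_regular_def by blast
  ultimately have v: "?v \<in> \<Theta>"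
    using assms(4,5) by (simp add: convexD)
  then have m: "\<theta> ?m = ?v"
    using \<theta>_bij by (simp add: param_mean_def bij_betw_inv_into_right)
  note mixture = geometric_mixture_eq[of \<theta> ?m, OF m, of M t k]
  have "(\<integral>x. ?p ?m x \<partial>M) = 1"
    using integral_ef_density[OF nonnull, of \<theta> ?m t k] v \<Theta>_subset m by auto
  then have "bhattacharyya_dist M \<alpha> (?p l1) (?p l2) = ?J"
    by (simp add: bhattacharyya_dist_def mixture)
  also have "\<dots> = ln (?p ?m \<omega> / (exp (- ?J) * ?p ?m \<omega>))"
    by (simp add: ef_density_def flip: exp_add exp_diff)
  finally show ?thesis
    by (simp only: mixture)
qed

end
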